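(* If $n\ge 3$ is an odd integer, then there is no magic polygon $P(n,2)$.
   Context: Magic polygon $P(n,2)$: take a regular polygon with $n$ sides ($n\ge 3$) and the $2n+1$ points consisting of its vertices $V_1,\dots,V_n$ (in cyclic order, indices modulo $n$), the midpoints $M_i$ of the edges $V_iV_{i+1}$, and its geometric center $C$. A magic polygon $P(n,2)$ is a labeling of these points by the numbers $1,2,\dots,2n+1$, each used exactly once, such that the sum of the values assigned to any three collinear points (among the $2n+1$ points) is a constant, called the magic sum. For $n$ odd, the collinear triples are $\{V_i,M_i,V_{i+1}\}$ and $\{V_i,C,M_{i+(n-1)/2}\}$ for $i$ modulo $n$. *)

theory Defs
  imports "HOL-Analysis.Analysis"
begin

text \<open>
  A regular \<open>n\<close>-gon in the Euclidean plane is given by its geometric center \<open>c\<close> and the vector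
  \<open>w \<noteq> 0\<close> from the center to its \<open>0\<close>-th vertex. As \<open>cis\<close> has period \<open>2\<pi>\<close>, the index \<open>i\<close> is
  automatically understood modulo \<open>n\<close>.
\<close>

definition polygon_vertex :: "complex \<Rightarrow> complex \<Rightarrow> nat \<Rightarrow> nat \<Rightarrow> complex" where
  "polygon_vertex c w n i = c + w * cis (2 * pi * real i / real n)"

definition polygon_midpoint :: "complex \<Rightarrow> complex \<Rightarrow> nat \<Rightarrow> nat \<Rightarrow> complex" where
  "polygon_midpoint c w n i = midpoint (polygon_vertex c w n i) (polygon_vertex c w n (i + 1))"

definition polygon_points :: "complex \<Rightarrow> complex \<Rightarrow> nat \<Rightarrow> complex set" where
  "polygon_points c w n =
     polygon_vertex c w n ` {..<n} \<union> polygon_midpoint c w n ` {..<n} \<union> {c}"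

text \<open>
  The points in a triple have to be pairwise distinct, since otherwise \<open>collinear\<close> holds trivially.
\<close>

definition magic_polygon :: "nat \<Rightarrow> complex \<Rightarrow> complex \<Rightarrow> (complex \<Rightarrow> nat) \<Rightarrow> bool" where
  "magic_polygon n c w f \<longleftrightarrow>
     n \<ge> 3 \<and> w \<noteq> 0 \<and>
     bij_betw f (polygon_points c w n) {1..2 * n + 1} \<and>
     (\<exists>s. \<forall>x \<in> polygon_points c w n. \<forall>y \<in> polygon_points c w n. \<forall>z \<in> polygon_points c w n.
        x \<noteq> y \<and> y \<noteq> z \<and> x \<noteq> z \<and> collinear {x, y, z} \<longrightarrow> f x + f y + f z = s)"

end

theory Submission
  imports Defs
begin

text \<open>
  Let \<open>n = 2h + 1\<close>. The midpoint opposite to the vertex \<open>V i\<close> lies on the edge from \<open>V (i + h)\<close>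
  to \<open>V (i + h + 1)\<close> and on the axis through \<open>V i\<close> and the center. Equating the sums on the edge
  and on the axis cancels the label of the midpoint: if \<open>u i\<close> is the label of \<open>V i\<close> minus the
  label of the center, then \<open>u (i + h) + u (i + h + 1) = u i\<close>. Together with the period \<open>n\<close> this
  recurrence gives \<open>u (i + h + 2) = - u i\<close>. By \<open>n\<close> steps of length \<open>h + 2\<close> one returns
  to the vertex of departure after an odd number of sign changes, hence \<open>u i = - u i\<close> and
  \<open>u = 0\<close> (\<open>recurrence_imp_zero\<close>). So every vertex would carry the label of the center, although
  labels are distinct. That the axes are lines through three distinct points of the figure rests
  on the position of the opposite midpoint, computed in \<open>opposite_midpoint\<close>.
\<close>

lemma sign_change_iterate:
  fixes u :: "nat \<Rightarrow> 'a :: ring_1"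
  assumes "\<And>i. u (i + k) = - u i"
  shows "u (i + j * k) = (-1) ^ j * u i"
proof (induction j)
  case (Suc j)
  have "u (i + Suc j * k) = u (i + j * k + k)"
    by (simp add: algebra_simps)
  then show ?case
    using assms Suc by simp
qed simp

lemma periodic_multiple:
  fixes u :: "nat \<Rightarrow> 'a"
  assumes "\<And>i. u (i + n) = u i"
  shows "u (i + n * j) = u i"
proof (induction j)
  case (Suc j)
  have "u (i + n * Suc j) = u (i + n * j + n)"
    by (simp add: algebra_simps)
  then show ?case
    using assms Suc by simp
qed simp

text \<open>
  Modulo the period \<open>2h + 1\<close> one has \<open>2 (h + 1) = 1\<close>, so in steps of \<open>h + 1\<close> the recurrence
  is that of the primitive sixth roots of unity, \<open>a (j + 2) = a (j + 1) - a j\<close>, whose solutions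
  change sign after three steps; and \<open>3 (h + 1)\<close> is \<open>h + 2\<close> modulo the period. A sign change
  is incompatible with an odd period unless the solution vanishes.
\<close>

lemma recurrence_imp_zero:
  fixes u :: "nat \<Rightarrow> 'a :: linordered_idom"
  assumes period: "\<And>i. u (i + (2 * h + 1)) = u i"
    and rec: "\<And>i. u (i + h) + u (i + h + 1) = u i"
  shows "u i = 0"
proof -
  \<comment> \<open>At \<open>i + h + 1\<close> the left side of the recurrence is one full period after \<open>i\<close>.\<close>
  have step: "u (i + h + 1) = u i + u (i + 1)" for i
  proof -
    have "u (i + h + 1) = u (i + (2 * h + 1)) + u (i + 1 + (2 * h + 1))"
      using rec[of "i + h + 1"] by (simp add: algebra_simps mult_2 mult_2_right)
    then show ?thesis
      by (simp only: period)
  qed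
  have flip: "u (i + (h + 2)) = - u i" for i
  proof -
    have "u (i + 1) = u (i + 1 + (2 * h + 1))"
      by (rule period[symmetric])
    also have "\<dots> = u (i + h + 1) + u (i + h + 2)"
      using step[of "i + h + 1"] by (simp add: algebra_simps mult_2 mult_2_right)
    finally show ?thesis
      using step[of i] by simp
  qed
  have "u i = u (i + (2 * h + 1) * (h + 2))"
    by (rule periodic_multiple[of u "2 * h + 1", OF period, symmetric])
  also have "\<dots> = (-1) ^ (2 * h + 1) * u i"
    by (rule sign_change_iterate[of u "h + 2", OF flip])
  finally show ?thesis
    by simp
qed

lemma polygon_vertex_period:
  assumes "n > 0"
  shows "polygon_vertex c w n (i + n) = polygon_vertex c w n i"
proof -
  have "2 * pi * real (i + n) / real n = 2 * pi * real i / real n + 2 * pi"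
    using assms by (simp add: field_simps)
  then show ?thesis
    by (simp add: polygon_vertex_def flip: cis_mult)
qed

lemma polygon_vertex_mod:
  assumes "n > 0"
  shows "polygon_vertex c w n (i mod n) = polygon_vertex c w n i"
  using periodic_multiple[of "polygon_vertex c w n" n "i mod n" "i div n",
      OF polygon_vertex_period[OF assms]]
  by simp

lemma polygon_midpoint_mod:
  assumes "n > 0"
  shows "polygon_midpoint c w n (i mod n) = polygon_midpoint c w n i"
proof -
  have "polygon_vertex c w n (i mod n + 1) = polygon_vertex c w n (i + 1)"
    by (metis polygon_vertex_mod[OF assms] mod_add_left_eq)
  then show ?thesis
    by (simp add: polygon_midpoint_def polygon_vertex_mod[OF assms])
qed

lemma polygon_points_mem:
  assumes "n > 0"
  shows "polygon_vertex c w n i \<in> polygon_points c w n"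
    and "polygon_midpoint c w n i \<in> polygon_points c w n"
    and "c \<in> polygon_points c w n"
proof -
  have "i mod n \<in> {..<n}"
    using assms by simp
  then have "polygon_vertex c w n (i mod n) \<in> polygon_points c w n"
    and "polygon_midpoint c w n (i mod n) \<in> polygon_points c w n"
    unfolding polygon_points_def by blast+
  then show "polygon_vertex c w n i \<in> polygon_points c w n"
    and "polygon_midpoint c w n i \<in> polygon_points c w n"
    by (simp_all add: polygon_vertex_mod[OF assms] polygon_midpoint_mod[OF assms])
  show "c \<in> polygon_points c w n"
    by (simp add: polygon_points_def)
qed

lemma polygon_vertex_neq_center:
  assumes "w \<noteq> 0"
  shows "polygon_vertex c w n i \<noteq> c"
  using assms by (simp add: polygon_vertex_def)

lemma polygon_vertex_neq_Suc:
  assumes "w \<noteq> 0" and "n \<ge> 2"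
  shows "polygon_vertex c w n i \<noteq> polygon_vertex c w n (i + 1)"
proof
  assume "polygon_vertex c w n i = polygon_vertex c w n (i + 1)"
  moreover have "2 * pi * real (i + 1) / real n = 2 * pi * real i / real n + 2 * (pi / real n)"
    by (simp add: field_simps add_divide_distrib)
  ultimately have "cis (2 * (pi / real n)) = 1"
    using assms by (simp add: polygon_vertex_def flip: cis_mult)
  then have "cos (2 * (pi / real n)) = 1"
    by (metis Re_complex_of_real cis.sel(1) of_real_1)
  then have "sin (pi / real n) = 0"
    using cos_double_sin[of "pi / real n"] by simp
  moreover have "sin (pi / real n) > 0"
    using assms by (intro sin_gt_zero) (auto simp: field_simps)
  ultimately show False
    by simp
qed

text \<open>
  Seen from the center, the ends of this edge lie in the direction opposite to the vertex \<open>i\<close>,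
  turned by \<open>\<pi> / n\<close> to either side. Their mean keeps that direction and is shortened by the
  factor \<open>cos (\<pi> / n)\<close>, the ratio of the apothem to the circumradius.
\<close>

lemma opposite_midpoint:
  assumes "n = 2 * h + 1"
  shows "polygon_midpoint c w n (i + h) - c =
    - cos (pi / real n) *\<^sub>R (polygon_vertex c w n i - c)"
proof -
  define a where "a = 2 * pi * real i / real n"
  define d where "d = pi / real n"
  have "2 * pi * real h / real n = pi - d"
  proof -
    have "2 * pi * real h = pi * real n - pi"
      using assms by (simp add: algebra_simps)
    then show ?thesis
      using assms by (simp add: d_def diff_divide_distrib)
  qed
  then have l: "2 * pi * real (i + h) / real n = (a + pi) - d"
    and r: "2 * pi * real (i + h + 1) / real n = (a + pi) + d"
    unfolding a_def d_def by (simp_all add: distrib_left add_divide_distrib)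
  have "cis ((a + pi) - d) + cis ((a + pi) + d) = - 2 * cos d *\<^sub>R cis a"
    by (simp add: complex_eq_iff cos_add cos_diff sin_add sin_diff)
  then have "w * cis ((a + pi) - d) + w * cis ((a + pi) + d) = - 2 * cos d *\<^sub>R (w * cis a)"
    by (simp flip: distrib_left)
  moreover have "polygon_midpoint c w n (i + h) - c =
      (1/2) *\<^sub>R (w * cis ((a + pi) - d) + w * cis ((a + pi) + d))"
    unfolding polygon_midpoint_def polygon_vertex_def midpoint_def l r
    by (simp add: scaleR_conv_of_real field_simps)
  ultimately show ?thesis
    by (simp add: polygon_vertex_def scaleR_conv_of_real flip: a_def d_def)
qed

text \<open>
  As \<open>n \<ge> 3\<close>, the apothem is positive, so the center lies strictly between the other two points.
\<close>

lemma axis_distinct_collinear: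
  fixes c w :: complex and n h i :: nat
  assumes "n = 2 * h + 1" and "n \<ge> 3" and "w \<noteq> 0"
  defines "v \<equiv> polygon_vertex c w n i" and "m \<equiv> polygon_midpoint c w n (i + h)"
  shows "v \<noteq> c" and "c \<noteq> m" and "v \<noteq> m" and "collinear {v, c, m}"
proof -
  have eq: "m - c = - cos (pi / real n) *\<^sub>R (v - c)"
    unfolding v_def m_def by (rule opposite_midpoint[OF assms(1)])
  have pos: "cos (pi / real n) > 0"
    using assms(2) by (intro cos_gt_zero) (auto simp: field_simps)
  show "v \<noteq> c"
    unfolding v_def using assms(3) by (rule polygon_vertex_neq_center)
  then show "c \<noteq> m"
    using eq pos by auto
  show "v \<noteq> m"
  proof
    assume "v = m"
    then have "v - c = - (cos (pi / real n) *\<^sub>R (v - c))"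
      by (metis eq scaleR_minus_left)
    then have "(1 + cos (pi / real n)) *\<^sub>R (v - c) = 0"
      by (simp only: scaleR_left_distrib scaleR_one flip: eq_neg_iff_add_eq_0)
    then show False
      using pos \<open>v \<noteq> c\<close> by simp
  qed
  show "collinear {v, c, m}"
  proof -
    have "collinear {0, v - c, m - c}"
      unfolding collinear_lemma using eq by blast
    then show ?thesis
      using collinear_3[of v c m] by (simp only: NO_MATCH_def simp_thms)
  qed
qed

theorem theorem4:
  fixes n :: nat
  assumes "n \<ge> 3" and "odd n"
  shows "\<not> (\<exists>c w f. magic_polygon n c w f)"
proof
  assume "\<exists>c w f. magic_polygon n c w f"
  then obtain c w f where "magic_polygon n c w f"
    by (elim exE)
  then obtain s where w: "w \<noteq> 0"
    and bij: "bij_betw f (polygon_points c w n) {1..2 * n + 1}"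
    and s: "\<forall>x \<in> polygon_points c w n. \<forall>y \<in> polygon_points c w n. \<forall>z \<in> polygon_points c w n.
      x \<noteq> y \<and> y \<noteq> z \<and> x \<noteq> z \<and> collinear {x, y, z} \<longrightarrow> f x + f y + f z = s"
    unfolding magic_polygon_def by (elim conjE exE)
  have magic: "f x + f y + f z = s"
    if "x \<in> polygon_points c w n" "y \<in> polygon_points c w n" "z \<in> polygon_points c w n"
      "x \<noteq> y" "y \<noteq> z" "x \<noteq> z" "collinear {x, y, z}" for x y z
    using s that by blast
  obtain h where h: "n = 2 * h + 1"
    using \<open>odd n\<close> by (elim oddE)
  have n: "n > 0" "n \<ge> 2"
    using \<open>n \<ge> 3\<close> by auto
  define V where "V = polygon_vertex c w n"
  define M where "M = polygon_midpoint c w n"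
  note mem = polygon_points_mem[OF n(1), of c w, folded V_def M_def]
  have edge: "f (V i) + f (M i) + f (V (i + 1)) = s" for i
  proof -
    have M: "M i = midpoint (V i) (V (i + 1))"
      by (simp add: M_def V_def polygon_midpoint_def)
    have "V i \<noteq> V (i + 1)"
      unfolding V_def by (rule polygon_vertex_neq_Suc[OF w n(2)])
    then have "V i \<noteq> M i" and "M i \<noteq> V (i + 1)"
      by (metis M midpoint_eq_endpoint)+
    moreover have "collinear {V i, M i, V (i + 1)}"
      unfolding M by (rule collinear_midpoint)
    ultimately show ?thesis
      using \<open>V i \<noteq> V (i + 1)\<close> by (intro magic mem)
  qed
  have axis: "f (V i) + f c + f (M (i + h)) = s" for i
    by (intro magic mem axis_distinct_collinear[OF h \<open>n \<ge> 3\<close> w, of c, folded V_def M_def])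
  define u where "u i = int (f (V i)) - int (f c)" for i
  have "u (i + (2 * h + 1)) = u i" for i
    using polygon_vertex_period[OF n(1), of c w i] by (simp add: u_def V_def h)
  moreover have "u (i + h) + u (i + h + 1) = u i" for i
    using edge[of "i + h"] axis[of i] by (simp add: u_def)
  ultimately have "u 0 = 0"
    by (rule recurrence_imp_zero)
  then have "f (V 0) = f c"
    by (simp add: u_def)
  then have "V 0 = c"
    using bij_betw_imp_inj_on[OF bij] mem(1,3) by (metis inj_onD)
  then show False
    using polygon_vertex_neq_center[OF w] by (simp add: V_def)
qed

end
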